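(* Let $G$ be a simple finite connected graph with chromatic number $\chi(G)\leq 5$. Then $\chi''(G)\leq \Delta(G)+3$.
   Context: $\Delta(G)$ denotes the maximum degree of $G$. A total coloring of $G$ is an assignment of colors to $V(G)\cup E(G)$ such that adjacent vertices get distinct colors, adjacent edges (edges sharing an endpoint) get distinct colors, and every edge gets a color different from the colors of both its endpoints. The total chromatic number $\chi''(G)$ is the minimum number of colors in a total coloring of $G$. *)

theory Defs
  imports Main
begin

definition simple_graph :: "'a set \<Rightarrow> 'a set set \<Rightarrow> bool" where
  "simple_graph V E \<longleftrightarrow> (\<forall>e\<in>E. e \<subseteq> V \<and> card e = 2)"

definition finite_simple_graph :: "'a set \<Rightarrow> 'a set set \<Rightarrow> bool" where
  "finite_simple_graph V E \<longleftrightarrow> finite V \<and> simple_graph V E"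

(* The graph without vertices does not count as connected (it has no maximum degree). *)
definition connected_graph :: "'a set \<Rightarrow> 'a set set \<Rightarrow> bool" where
  "connected_graph V E \<longleftrightarrow>
     V \<noteq> {} \<and> (\<forall>u\<in>V. \<forall>v\<in>V. (u, v) \<in> {(x, y). {x, y} \<in> E}\<^sup>*)"

definition degree :: "'a set set \<Rightarrow> 'a \<Rightarrow> nat" where
  "degree E v = card {e \<in> E. v \<in> e}"

definition max_degree :: "'a set \<Rightarrow> 'a set set \<Rightarrow> nat" where
  "max_degree V E = Max (degree E ` V)"

definition proper_coloring :: "'a set \<Rightarrow> 'a set set \<Rightarrow> ('a \<Rightarrow> nat) \<Rightarrow> bool" where
  "proper_coloring V E c \<longleftrightarrow> (\<forall>u\<in>V. \<forall>v\<in>V. {u, v} \<in> E \<longrightarrow> c u \<noteq> c v)"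

definition colorable :: "'a set \<Rightarrow> 'a set set \<Rightarrow> nat \<Rightarrow> bool" where
  "colorable V E k \<longleftrightarrow> (\<exists>c. proper_coloring V E c \<and> c ` V \<subseteq> {..<k})"

definition chromatic_number :: "'a set \<Rightarrow> 'a set set \<Rightarrow> nat" where
  "chromatic_number V E = (LEAST k. colorable V E k)"

(* A map on the disjoint union of V and E is given by its restrictions f to V and g to E. *)
definition total_coloring ::
  "'a set \<Rightarrow> 'a set set \<Rightarrow> ('a \<Rightarrow> nat) \<Rightarrow> ('a set \<Rightarrow> nat) \<Rightarrow> bool" where
  "total_coloring V E f g \<longleftrightarrow>
     (\<forall>u\<in>V. \<forall>v\<in>V. {u, v} \<in> E \<longrightarrow> f u \<noteq> f v) \<and>
     (\<forall>e\<in>E. \<forall>e'\<in>E. e \<noteq> e' \<and> e \<inter> e' \<noteq> {} \<longrightarrow> g e \<noteq> g e') \<and>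
     (\<forall>e\<in>E. \<forall>v\<in>e. g e \<noteq> f v)"

definition total_colorable :: "'a set \<Rightarrow> 'a set set \<Rightarrow> nat \<Rightarrow> bool" where
  "total_colorable V E k \<longleftrightarrow>
     (\<exists>f g. total_coloring V E f g \<and> f ` V \<union> g ` E \<subseteq> {..<k})"

definition total_chromatic_number :: "'a set \<Rightarrow> 'a set set \<Rightarrow> nat" where
  "total_chromatic_number V E = (LEAST k. total_colorable V E k)"

(* Both minima are attained for finite simple graphs, so LEAST never takes a junk value there. *)

lemma finite_simple_graph_finite_edges:
  assumes "finite_simple_graph V E"
  shows "finite E"
proof (rule finite_subset)
  show "E \<subseteq> Pow V"
    using assms by (auto simp: finite_simple_graph_def simple_graph_def)
  show "finite (Pow V)"
    using assms by (simp add: finite_simple_graph_def)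
qed

lemma colorable_chromatic_number:
  assumes "finite_simple_graph V E"
  shows "colorable V E (chromatic_number V E)"
proof -
  have "finite V"
    using assms by (simp add: finite_simple_graph_def)
  then obtain c :: "'a \<Rightarrow> nat" and n where c: "c ` V = {i. i < n}" "inj_on c V"
    using finite_imp_inj_to_nat_seg by metis
  have "c u \<noteq> c v" if "u \<in> V" "v \<in> V" "{u, v} \<in> E" for u v
  proof -
    have "card {u, v} = 2"
      using assms that by (auto simp: finite_simple_graph_def simple_graph_def)
    then have "u \<noteq> v" by auto
    then show ?thesis using c(2) that by (auto dest: inj_onD)
  qed
  then have "colorable V E n"
    using c(1) unfolding colorable_def proper_coloring_def by blast
  then show ?thesis
    unfolding chromatic_number_def by (rule LeastI)
qed

lemma total_colorable_total_chromatic_number: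
  assumes "finite_simple_graph V E"
  shows "total_colorable V E (total_chromatic_number V E)"
proof -
  have "finite V"
    using assms by (simp add: finite_simple_graph_def)
  then obtain f :: "'a \<Rightarrow> nat" and n where f: "f ` V = {i. i < n}" "inj_on f V"
    using finite_imp_inj_to_nat_seg by metis
  have "finite E"
    using assms by (rule finite_simple_graph_finite_edges)
  then obtain h :: "'a set \<Rightarrow> nat" and m where h: "h ` E = {i. i < m}" "inj_on h E"
    using finite_imp_inj_to_nat_seg by metis
  define g where "g e = n + h e" for e
  have "f u \<noteq> f v" if "u \<in> V" "v \<in> V" "{u, v} \<in> E" for u v
  proof -
    have "card {u, v} = 2"
      using assms that by (auto simp: finite_simple_graph_def simple_graph_def)
    then have "u \<noteq> v" by auto
    then show ?thesis using f(2) that by (auto dest: inj_onD)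
  qed
  moreover have "g e \<noteq> g e'" if "e \<in> E" "e' \<in> E" "e \<noteq> e'" for e e'
    using h(2) that by (auto simp: g_def dest: inj_onD)
  moreover have "g e \<noteq> f v" if "e \<in> E" "v \<in> e" for e v
  proof -
    have "v \<in> V"
      using assms that by (auto simp: finite_simple_graph_def simple_graph_def)
    then have "f v < n" using f(1) by blast
    then show ?thesis by (simp add: g_def)
  qed
  ultimately have "total_coloring V E f g"
    unfolding total_coloring_def by blast
  moreover have "f ` V \<union> g ` E \<subseteq> {..<n + m}"
    using f(1) h(1) by (auto simp: g_def)
  ultimately have "total_colorable V E (n + m)"
    unfolding total_colorable_def by blast
  then show ?thesis
    unfolding total_chromatic_number_def by (rule LeastI)
qed

end

theory Submission
  imports Defs "HOL-Combinatorics.Transposition"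
begin

text \<open>
  Let \<open>D \<ge> 2\<close> be the maximum degree. Start from a proper vertex coloring with classes \<open>0, \<dots>, 4\<close> and,
  by Vizing's theorem, a proper edge coloring with \<open>0, \<dots>, D\<close>. Shift the edge colors by 2 and recolor the
  set \<open>F\<close> of edges that had color 0 or 1 from \<open>{0, 1, 2, 3}\<close>: classes 0 to 3 keep their vertex colors, so an
  edge of \<open>F\<close> retains at least two admissible colors, and \<open>F\<close> consists of paths and even cycles, which are
  2-choosable. A vertex of class 4 receives a shifted color that it misses. This fails only for the vertices
  \<open>b\<close> that see all of the colors \<open>2, \<dots>, D\<close>; they form an independent set and meet at most one edge of
  \<open>F\<close>. Such a \<open>b\<close> receives the shifted color of its edge of color 2, and that edge \<open>{b, u b}\<close> is also
  recolored from \<open>{0, 1, 2, 3}\<close>, together with the edge \<open>{b, w b}\<close> of \<open>F\<close>, after the rest of \<open>F\<close>.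
  The colors of these pairs of edges can be chosen greedily, pair by pair, until the pairs that remain form
  disjoint even cycles with two admissible colors on each edge.
\<close>

section \<open>Vizing's theorem\<close>


definition edge_coloring :: "'a set set \<Rightarrow> ('a set \<Rightarrow> nat) \<Rightarrow> bool" where
  "edge_coloring E c \<longleftrightarrow> (\<forall>e\<in>E. \<forall>e'\<in>E. e \<noteq> e' \<and> e \<inter> e' \<noteq> {} \<longrightarrow> c e \<noteq> c e')"

definition missing :: "'a set set \<Rightarrow> ('a set \<Rightarrow> nat) \<Rightarrow> nat \<Rightarrow> 'a \<Rightarrow> nat set" where
  "missing E c k v = {i. i < k \<and> (\<forall>e\<in>E. v \<in> e \<longrightarrow> c e \<noteq> i)}"

text \<open>A Vizing fan at \<open>v\<close> is encoded as a walk in this relation, so vertices may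
  repeat and the fan vertices form a reachability set.\<close>

definition fan :: "'a set set \<Rightarrow> ('a set \<Rightarrow> nat) \<Rightarrow> nat \<Rightarrow> 'a \<Rightarrow> 'a \<Rightarrow> 'a \<Rightarrow> bool" where
  "fan E c k v x y \<longleftrightarrow> {v, y} \<in> E \<and> c {v, y} \<in> missing E c k x"

lemma edge_coloringD:
  "\<lbrakk>edge_coloring E c; e \<in> E; e' \<in> E; x \<in> e; x \<in> e'; c e = c e'\<rbrakk> \<Longrightarrow> e = e'"
  unfolding edge_coloring_def by blast

lemma card_2_memE:
  assumes "card e = 2" "v \<in> e"
  obtains z where "e = {v, z}" "z \<noteq> v"
  using assms by (auto simp: card_2_iff)

lemma finite_degree_missing:
  assumes "finite E" "degree E v < k"
  shows "missing E c k v \<noteq> {}"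
proof
  assume *: "missing E c k v = {}"
  have "{..<k} \<subseteq> c ` {e \<in> E. v \<in> e}"
    using * unfolding missing_def by blast
  then have "k \<le> card (c ` {e \<in> E. v \<in> e})"
    using card_mono[of "c ` {e \<in> E. v \<in> e}" "{..<k}"] assms(1) by simp
  also have "\<dots> \<le> degree E v"
    unfolding degree_def by (rule card_image_le) (use assms(1) in simp)
  finally show False using assms(2) by simp
qed

text \<open>\<open>R True\<close> and \<open>R False\<close> model two color classes, each a
  matching. As \<open>v\<close> meets no edge of type \<open>True\<close>, its component is traced
  by one alternating walk, and a vertex without an edge of type \<open>False\<close> can only be the
  last vertex of that walk.\<close>

lemma alternating_path_end_unique:
  fixes R :: "bool \<Rightarrow> 'a \<Rightarrow> 'a \<Rightarrow> bool"
  assumes sym: "\<And>b x y. R b x y \<Longrightarrow> R b y x"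
    and uniq: "\<And>b x y z. R b x y \<Longrightarrow> R b x z \<Longrightarrow> y = z"
    and v: "\<And>y. \<not> R True v y" and x: "\<And>z. \<not> R False x z" and y: "\<And>z. \<not> R False y z"
    and reach: "(\<lambda>a b. \<exists>i. R i a b)\<^sup>*\<^sup>* v x" "(\<lambda>a b. \<exists>i. R i a b)\<^sup>*\<^sup>* v y"
  shows "x = y"
proof -
  \<comment> \<open>\<open>W n\<close> holds of the vertex reached after \<open>n\<close> steps from
    \<open>v\<close>, the first step being of type \<open>False\<close>; the predicate is empty once
    the walk has ended.\<close>
  define W where "W = rec_nat (\<lambda>z. z = v) (\<lambda>n P z. \<exists>a. P a \<and> R (odd n) a z)"
  have W0: "W 0 z \<longleftrightarrow> z = v" for z by (simp add: W_def)
  have WS: "W (Suc n) z \<longleftrightarrow> (\<exists>a. W n a \<and> R (odd n) a z)" for n z by (simp add: W_def)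
  have det: "W n a \<Longrightarrow> W n b \<Longrightarrow> a = b" for n a b
  proof (induction n arbitrary: a b)
    case 0 then show ?case by (simp add: W0)
  next
    case (Suc n) then show ?case unfolding WS using uniq by metis
  qed
  have closed: "\<exists>n. W n b" if wn: "W n a" "R i a b" for n a b i
  proof (cases "i = odd n")
    case True then show ?thesis using that WS by blast
  next
    case False
    show ?thesis
    proof (cases n)
      case 0 then show ?thesis using that False W0 v by auto
    next
      case (Suc m)
      then obtain d where d: "W m d" "R (odd m) d a" using wn(1) WS by auto
      have "i = odd m" using False Suc by auto
      then have "d = b" using uniq sym d(2) that(2) by blast
      then show ?thesis using d by blast
    qed
  qed
  have ex: "\<exists>n. W n z" if "(\<lambda>a b. \<exists>i. R i a b)\<^sup>*\<^sup>* v z" for z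
    using that by induction (use W0 closed in blast)+
  \<comment> \<open>Such a vertex is \<open>v\<close> or was entered by an edge of type
    \<open>True\<close>; the next step would have to be of type \<open>False\<close>, so the walk
    stops there.\<close>
  have ev: "even n" if wn: "W n z" "\<And>d. \<not> R False z d" for n z
  proof (cases n)
    case (Suc m)
    then obtain d where "W m d" "R (odd m) d z" using wn(1) WS by auto
    then have "odd m" using sym that(2) by (cases "odd m") auto
    then show ?thesis using Suc by simp
  qed simp
  have pred: "\<exists>a. W n a" if "W m b" "n \<le> m" for n m b
    using that
  proof (induction m arbitrary: b)
    case 0
    then show ?case by auto
  next
    case (Suc m)
    then show ?case using WS le_Suc_eq by blast
  qed
  have nl: "\<not> n < m" if wn: "W n z" "\<And>d. \<not> R False z d" "W m b" for n m z b
  proof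
    assume "n < m"
    then obtain a where "W (Suc n) a" using pred[OF wn(3), of "Suc n"] by auto
    then obtain d where "W n d" "R (odd n) d a" using WS by auto
    then show False using det[OF wn(1)] ev[OF wn(1,2)] wn(2) by auto
  qed
  obtain n m where "W n x" "W m y" using ex reach by blast
  then show ?thesis using nl x y det by (metis linorder_neqE_nat)
qed

lemma successively_if_tl:
  assumes "successively P (x # xs)"
    and "\<And>a b. a \<in> set (x # xs) \<Longrightarrow> b \<in> set xs \<Longrightarrow> P a b \<Longrightarrow> Q a b"
  shows "successively Q (x # xs)"
  using assms by (induction xs arbitrary: x) auto

text \<open>The color of the next fan edge \<open>{v, y}\<close> is missing at \<open>x\<close>, so
  it can move to \<open>{v, x}\<close>; then \<open>{v, y}\<close> is the uncolored edge and the fan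
  is shorter. At the end of the fan, a color missing at both ends of the uncolored edge is
  available.\<close>

lemma fan_shift:
  assumes "edge_coloring E c" "c ` E \<subseteq> {..<k}" "\<forall>e\<in>E. card e = 2"
    and "{v, x} \<notin> E" "x \<noteq> v"
    and "successively (fan E c k v) (x # ys)"
    and "missing E c k (last (x # ys)) \<inter> missing E c k v \<noteq> {}"
  shows "\<exists>c'. edge_coloring (insert {v, x} E) c' \<and> c' ` insert {v, x} E \<subseteq> {..<k}"
  using assms
proof (induction "length ys" arbitrary: ys x E c rule: less_induct)
  case less
  show ?case
  proof (cases ys)
    case Nil
    then obtain i where i: "i \<in> missing E c k x" "i \<in> missing E c k v" using less.prems by auto
    have "edge_coloring (insert {v, x} E) (c({v, x} := i))"
      using i less.prems(1,4) unfolding edge_coloring_def missing_def by auto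
    moreover have "(c({v, x} := i)) ` insert {v, x} E \<subseteq> {..<k}"
      using i less.prems(2) unfolding missing_def by auto
    ultimately show ?thesis by blast
  next
    case (Cons y zs)
    show ?thesis
    proof (cases "y \<in> set zs")
      \<comment> \<open>Cutting out the stretch between two occurrences of \<open>y\<close> gives a
        shorter walk with the same end.\<close>
      case True
      then obtain as bs where s: "zs = as @ y # bs" by (meson split_list)
      have su: "successively (fan E c k v) (x # y # bs)"
        using less.prems(6) Cons s by (auto simp: successively_append_iff successively_Cons)
      have la: "last (x # ys) = last (x # y # bs)" using Cons s by simp
      have "length (y # bs) < length ys" using Cons s by simp
      from less.hyps[OF this less.prems(1-5) su] show ?thesis
        using less.prems(7) unfolding la by blast
    next
      case False
      let ?g = "c {v, y}" let ?E = "insert {v, x} (E - {{v, y}})" let ?c = "c({v, x} := c {v, y})"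
      have f: "{v, y} \<in> E" "?g \<in> missing E c k x"
        using less.prems(6) Cons by (auto simp: fan_def successively_Cons)
      have yv: "y \<noteq> v" and xy: "x \<noteq> y" using f less.prems(3,4) by auto
      have mem: "{v, z} \<in> E" if zin: "z \<in> set ys" for z
      proof -
        obtain as bs where "ys = as @ z # bs" using split_list[OF zin] by blast
        then have "successively (fan E c k v) ((x # as) @ z # bs)" using less.prems(6) by simp
        then have "fan E c k v (last (x # as)) z"
          unfolding successively_append_iff by simp
        then show ?thesis by (simp add: fan_def)
      qed
      have nx: "z \<noteq> x \<and> z \<noteq> v" if "z \<in> set ys" for z using mem[OF that] less.prems(3,4) by auto
      \<comment> \<open>Only \<open>x\<close> gains a color in the shift; at \<open>v\<close> the
        color of \<open>{v, y}\<close> merely moves to another edge.\<close>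
      have m: "missing E c k z \<subseteq> missing ?E ?c k z" if "z \<noteq> x" "z \<noteq> v" for z
        using that unfolding missing_def by auto
      have mv: "missing E c k v \<subseteq> missing ?E ?c k v"
        using f unfolding missing_def by auto
      have ec: "edge_coloring ?E ?c"
        unfolding edge_coloring_def
      proof (intro ballI impI)
        have new: "?g \<noteq> c e" if e: "e \<in> E" "e \<noteq> {v, y}" "e \<inter> {v, x} \<noteq> {}" for e
        proof (cases "v \<in> e")
          case True
          then show ?thesis using edge_coloringD[OF less.prems(1) f(1) e(1), of v] e(2) by blast
        next
          case False
          then have "x \<in> e" using e(3) by blast
          then have "c e \<noteq> ?g" using f(2) e(1) unfolding missing_def by blast
          then show ?thesis by simp
        qed
        fix e e' assume e: "e \<in> ?E" "e' \<in> ?E" "e \<noteq> e' \<and> e \<inter> e' \<noteq> {}"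
        have i: "e' \<inter> e \<noteq> {}" using e(3) by blast
        have old: "e \<noteq> {v, x} \<Longrightarrow> e \<in> E \<and> e \<noteq> {v, y}" "e' \<noteq> {v, x} \<Longrightarrow> e' \<in> E \<and> e' \<noteq> {v, y}"
          using e by blast+
        show "?c e \<noteq> ?c e'"
        proof (cases "e = {v, x}")
          case True
          then have "e' \<noteq> {v, x}" using e(3) by blast
          then show ?thesis using True new[of e'] old(2) i by simp
        next
          case ne: False
          show ?thesis
          proof (cases "e' = {v, x}")
            case True
            then show ?thesis using new[of e] old(1)[OF ne] e(3) ne by simp
          next
            case False
            then have "c e \<noteq> c e'"
              using less.prems(1) old(1)[OF ne] old(2) e(3) unfolding edge_coloring_def by blast
            then show ?thesis using ne False by simp
          qed
        qed
      qed
      have "successively (fan E c k v) (y # zs)" using less.prems(6) Cons by (simp add: successively_Cons)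
      \<comment> \<open>As \<open>y\<close> does not recur, no later fan edge is the edge that has
        lost its color.\<close>
      then have su: "successively (fan ?E ?c k v) (y # zs)"
      proof (rule successively_if_tl)
        fix a b assume "a \<in> set (y # zs)" "b \<in> set zs" "fan E c k v a b"
        moreover have "{v, b} \<noteq> {v, y}" "{v, b} \<noteq> {v, x}" "a \<noteq> x" "a \<noteq> v"
          using False nx calculation(1,2) Cons by (auto simp: doubleton_eq_iff)
        ultimately show "fan ?E ?c k v a b" using m[of a] by (auto simp: fan_def)
      qed
      have "\<exists>c'. edge_coloring (insert {v, y} ?E) c' \<and> c' ` insert {v, y} ?E \<subseteq> {..<k}"
      proof (rule less.hyps[of zs ?E ?c y])
        show "successively (fan ?E ?c k v) (y # zs)" by (rule su)
        show "length zs < length ys" using Cons by simp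
        show "?c ` ?E \<subseteq> {..<k}" using less.prems(2) f(1) by auto
        show "\<forall>e\<in>?E. card e = 2" using less.prems(3,5) by auto
        show "{v, y} \<notin> ?E" using xy yv by (auto simp: doubleton_eq_iff)
        show "missing ?E ?c k (last (y # zs)) \<inter> missing ?E ?c k v \<noteq> {}"
        proof -
          let ?l = "last (y # zs)"
          have l: "?l \<in> set ys" "last (x # ys) = ?l" using Cons by auto
          show ?thesis using less.prems(7)[unfolded l(2)] m[of ?l] mv nx[OF l(1)] by blast
        qed
      qed (fact yv ec)+
      then show ?thesis using f by (simp add: insert_absorb insert_commute)
    qed
  qed
qed

lemma fan_shift_reachable:
  assumes "edge_coloring E c" "c ` E \<subseteq> {..<k}" "\<forall>e\<in>E. card e = 2"
    and "{v, x} \<notin> E" "x \<noteq> v"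
    and "(fan E c k v)\<^sup>*\<^sup>* x y"
    and "missing E c k y \<inter> missing E c k v \<noteq> {}"
  shows "\<exists>c'. edge_coloring (insert {v, x} E) c' \<and> c' ` insert {v, x} E \<subseteq> {..<k}"
proof -
  have "\<exists>ys. successively (fan E c k v) (x # ys) \<and> last (x # ys) = y"
    using assms(6)
  proof induction
    case base
    show ?case by (rule exI[of _ "[]"]) simp
  next
    case (step y z)
    then obtain ys where ys: "successively (fan E c k v) (x # ys)" "last (x # ys) = y" by blast
    then have "successively (fan E c k v) ((x # ys) @ [z])"
      unfolding successively_append_iff using step(2) by simp
    then show ?case by (intro exI[of _ "ys @ [z]"]) simp
  qed
  then show ?thesis using fan_shift[OF assms(1-5)] assms(7) by blast
qed

text \<open>\<open>C\<close> is a union of components of the subgraph of colors \<open>a\<close> and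
  \<open>b\<close>. Swapping outside \<open>C\<close> permutes the colors at each vertex:
  identically inside \<open>C\<close>, by the transposition outside.\<close>

lemma kempe_swap:
  assumes col: "edge_coloring E c"
    and C: "\<forall>e\<in>E. c e \<in> {a, b} \<longrightarrow> e \<inter> C \<noteq> {} \<longrightarrow> e \<subseteq> C"
  defines "c' \<equiv> \<lambda>e. if e \<inter> C = {} then transpose a b (c e) else c e"
  shows "edge_coloring E c'"
    and "u \<in> C \<Longrightarrow> missing E c' k u = missing E c k u"
    and "u \<notin> C \<Longrightarrow> a < k \<Longrightarrow> b < k \<Longrightarrow> missing E c' k u = transpose a b ` missing E c k u"
proof -
  \<comment> \<open>An edge between \<open>C\<close> and its complement has neither color, so the
    transposition fixes its color.\<close>
  have tr: "c' e = transpose a b (c e)" if "e \<in> E" "u \<in> e" "u \<notin> C" for e u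
    using C that by (auto simp: c'_def transpose_def)
  have id: "c' e = c e" if "u \<in> e" "u \<in> C" for e u
    using that by (auto simp: c'_def)
  show "edge_coloring E c'"
    unfolding edge_coloring_def
  proof (intro ballI impI)
    fix e e' assume e: "e \<in> E" "e' \<in> E" "e \<noteq> e' \<and> e \<inter> e' \<noteq> {}"
    then obtain u where u: "u \<in> e" "u \<in> e'" by blast
    have "c e \<noteq> c e'" using col e unfolding edge_coloring_def by blast
    then show "c' e \<noteq> c' e'"
      using tr[OF e(1) u(1)] tr[OF e(2) u(2)] id[OF u(1)] id[OF u(2)] 
      by (cases "u \<in> C") (auto dest: transpose_eq_imp_eq)
  qed
  show "missing E c' k u = missing E c k u" if "u \<in> C"
    using id that unfolding missing_def by auto
  show "missing E c' k u = transpose a b ` missing E c k u" if "u \<notin> C" "a < k" "b < k"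
  proof -
    have lt: "transpose a b i < k \<longleftrightarrow> i < k" for i using that by (auto simp: transpose_def)
    have eq: "c' e = i \<longleftrightarrow> c e = transpose a b i" if "e \<in> E" "u \<in> e" for e i
      using tr[OF that \<open>u \<notin> C\<close>] by (auto simp only: transpose_def split: if_splits)
    have "i \<in> missing E c' k u \<longleftrightarrow> transpose a b i \<in> missing E c k u" for i
      using eq lt unfolding missing_def by blast
    then show ?thesis by (simp add: set_eq_iff in_transpose_image_iff)
  qed
qed

text \<open>If no extension exists, no fan vertex shares a missing color with \<open>v\<close>.
  Counting yields two fan vertices that miss a common color \<open>b\<close>, and a Kempe swap makes
  one of them miss a color \<open>a\<close> that \<open>v\<close> misses, while it stays a fan
  vertex.\<close>

lemma vizing_extend:
  assumes fin: "finite E" and two: "\<forall>e\<in>E. card e = 2" and col: "edge_coloring E c" "c ` E \<subseteq> {..<k}"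
    and new: "{v, x} \<notin> E" "x \<noteq> v" and deg: "\<And>u. degree E u < k"
  shows "\<exists>c'. edge_coloring (insert {v, x} E) c' \<and> c' ` insert {v, x} E \<subseteq> {..<k}"
proof (rule ccontr)
  assume no: "\<not> ?thesis"
  let ?m = "missing E c k"
  define X where "X = {y. (fan E c k v)\<^sup>*\<^sup>* x y}"
  have disj: "?m y \<inter> ?m v = {}" if "y \<in> X" for y
    using fan_shift_reachable[OF col two new] no that unfolding X_def by blast
  define \<mu> where "\<mu> y = (SOME i. i \<in> ?m y)" for y
  have \<mu>: "\<mu> y \<in> ?m y" for y
    unfolding \<mu>_def using finite_degree_missing[OF fin deg] by (rule some_in_eq[THEN iffD2])
  have Xx: "x \<in> X" by (simp add: X_def)
  have XE: "{v, y} \<in> E" if "y \<in> X - {x}" for y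
  proof -
    have "(fan E c k v)\<^sup>*\<^sup>* x y" "y \<noteq> x" using that by (auto simp: X_def)
    then obtain u where "fan E c k v u y" by (meson rtranclp.cases)
    then show ?thesis by (simp add: fan_def)
  qed
  have "X \<subseteq> insert x (\<Union>E)" using XE by auto
  moreover have "finite (\<Union>E)" using fin two by (metis card.infinite finite_Union zero_neq_numeral)
  ultimately have finX: "finite X" by (meson finite.insertI finite_subset)
  \<comment> \<open>The edge at \<open>v\<close> of color \<open>\<mu> y\<close> leads to a fan
    vertex other than \<open>x\<close>, so \<open>\<mu>\<close> has fewer than \<open>card X\<close>
    values.\<close>
  have "\<mu> ` X \<subseteq> (\<lambda>z. c {v, z}) ` (X - {x})"
  proof safe
    fix y assume y: "y \<in> X"
    then have "\<mu> y < k" "\<mu> y \<notin> ?m v" using \<mu>[of y] disj[of y] by (auto simp: missing_def)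
    then obtain e where e: "e \<in> E" "v \<in> e" "c e = \<mu> y" by (auto simp: missing_def)
    then obtain z where z: "e = {v, z}" using two by (metis card_2_memE)
    then have "fan E c k v y z" using e \<mu>[of y] by (simp add: fan_def)
    then have "z \<in> X" using y by (auto simp: X_def)
    moreover have "z \<noteq> x" using new e z by auto
    ultimately show "\<mu> y \<in> (\<lambda>z. c {v, z}) ` (X - {x})" using e z by force
  qed
  then have "card (\<mu> ` X) \<le> card ((\<lambda>z. c {v, z}) ` (X - {x}))"
    using finX by (intro card_mono) auto
  also have "\<dots> \<le> card (X - {x})" using finX by (intro card_image_le) auto
  also have "\<dots> < card X" using finX Xx by (rule card_Diff1_less)
  finally have "\<not> inj_on \<mu> X" by (metis card_image less_irrefl)
  then obtain y z where yz: "y \<in> X" "z \<in> X" "y \<noteq> z" "\<mu> y = \<mu> z" unfolding inj_on_def by blast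
  define b where "b = \<mu> y"
  define a where "a = \<mu> v"
  have b: "b \<in> ?m y" "b \<in> ?m z" and a: "a \<in> ?m v" using \<mu> yz(4) by (auto simp: a_def b_def) (metis)
  have ab: "a \<noteq> b" "a < k" "b < k" using a b disj[OF yz(1)] by (auto simp: missing_def)
  define R where "R i s t \<longleftrightarrow> {s, t} \<in> E \<and> c {s, t} = (if i then a else b)" for i s t
  define C where "C = {u. (\<lambda>s t. \<exists>i. R i s t)\<^sup>*\<^sup>* v u}"
  have vC: "v \<in> C" by (simp add: C_def)
  have "y = z" if "y \<in> C" "z \<in> C"
  proof (rule alternating_path_end_unique[of R v])
    show "R i t s" if "R i s t" for i s t using that by (simp add: R_def insert_commute)
    show "t = t'" if "R i s t" "R i s t'" for i s t t'
      using edge_coloringD[OF col(1), of "{s, t}" "{s, t'}" s] that by (auto simp: R_def doubleton_eq_iff)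
    show "\<not> R True v t" for t using a by (auto simp: R_def missing_def)
    show "\<not> R False y t" for t using b(1) by (auto simp: R_def missing_def)
    show "\<not> R False z t" for t using b(2) by (auto simp: R_def missing_def)
  qed (use that in \<open>simp_all add: C_def\<close>)
  then obtain w where w: "w \<in> X" "w \<notin> C" "b \<in> ?m w" using yz b by blast
  have closed: "e \<subseteq> C" if e: "e \<in> E" "c e = a \<or> c e = b" "e \<inter> C \<noteq> {}" for e
  proof -
    obtain s where s: "s \<in> e" "s \<in> C" using e by blast
    then obtain t where t: "e = {s, t}" using two e by (metis card_2_memE)
    then have "\<exists>i. R i s t" using e unfolding R_def by (metis (full_types))
    then have "t \<in> C" using s unfolding C_def by (metis (mono_tags, lifting) mem_Collect_eq rtranclp.rtrancl_into_rtrancl)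
    then show ?thesis using s t by simp
  qed
  define c' where "c' = (\<lambda>e. if e \<inter> C = {} then transpose a b (c e) else c e)"
  have "\<forall>e\<in>E. c e \<in> {a, b} \<longrightarrow> e \<inter> C \<noteq> {} \<longrightarrow> e \<subseteq> C" using closed by simp
  note ks = kempe_swap[OF col(1) this, folded c'_def]
  have ec: "edge_coloring E c'" by (rule ks(1))
  have mC: "missing E c' k u = ?m u" if "u \<in> C" for u by (rule ks(2)[OF that])
  have mN: "missing E c' k u = transpose a b ` ?m u" if "u \<notin> C" for u by (rule ks(3)[OF that ab(2,3)])
  have rng: "c' ` E \<subseteq> {..<k}" using col(2) ab by (auto simp: c'_def transpose_def)
  have disj': "missing E c' k u \<inter> missing E c' k v = {}" if "(fan E c' k v)\<^sup>*\<^sup>* x u" for u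
    using fan_shift_reachable[OF ec rng two new that] no by blast
  have a': "a \<in> missing E c' k v" using mC[OF vC] a by simp
  have sw: "a \<in> missing E c' k u" if "u \<notin> C" "b \<in> ?m u" for u
    using mN[OF that(1)] that(2) by (metis image_eqI transpose_apply_second)
  \<comment> \<open>The colors at \<open>v\<close> do not change. A fan step can only break if its
    color is \<open>b\<close> and it starts outside \<open>C\<close>; but that starting vertex would
    now miss \<open>a\<close>, as \<open>v\<close> does, contrary to \<open>disj'\<close>.\<close>
  have "(fan E c' k v)\<^sup>*\<^sup>* x u" if "u \<in> X" for u
    using that[unfolded X_def mem_Collect_eq]
  proof induction
    case (step u t)
    have ct: "c' {v, t} = c {v, t}" using vC by (simp add: c'_def)
    have f: "{v, t} \<in> E" "c {v, t} \<in> ?m u" using step(2) by (auto simp: fan_def)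
    have na: "c {v, t} \<noteq> a" using a f(1) by (auto simp: missing_def)
    have "c {v, t} \<in> missing E c' k u"
    proof (cases "u \<in> C")
      case True
      then show ?thesis using mC f by simp
    next
      case False
      then have "c {v, t} \<noteq> b" using sw[of u] a' disj'[OF step(3)] f(2) by blast
      then show ?thesis using mN[OF False] f(2) na by (metis image_eqI transpose_apply_other)
    qed
    then have "fan E c' k v u t" using f ct by (simp add: fan_def)
    then show ?case using step(3) by simp
  qed simp
  then show False using sw[OF w(2,3)] a' disj' w(1) by blast
qed

lemma degree_mono: "finite F \<Longrightarrow> E \<subseteq> F \<Longrightarrow> degree E u \<le> degree F u"
  unfolding degree_def by (rule card_mono) auto

text \<open>The usual form is the case where \<open>k\<close> is the maximum degree plus
  one.\<close>

theorem vizing: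
  assumes "finite E" "\<forall>e\<in>E. card e = 2" "\<And>u. degree E u < k"
  shows "\<exists>c. edge_coloring E c \<and> c ` E \<subseteq> {..<k}"
  using assms
proof (induction E rule: finite_induct)
  case empty
  then show ?case by (auto simp: edge_coloring_def)
next
  case (insert e E)
  obtain v x where e: "e = {v, x}" "x \<noteq> v" using insert.prems(1) by (auto simp: card_2_iff)
  have deg: "degree E u < k" for u
    using degree_mono[of "insert e E" E u] insert.hyps(1) insert.prems(2)[of u]
    by (meson finite.insertI le_less_trans subset_insertI)
  obtain c where "edge_coloring E c" "c ` E \<subseteq> {..<k}"
    using insert.IH deg insert.prems(1) by auto
  then show ?case
    using vizing_extend[OF insert.hyps(1) _ _ _ _ e(2) deg] insert.prems(1) insert.hyps(2) e(1) by auto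
qed

section \<open>List colorings\<close>

text \<open>The exceptional vertex \<open>z\<close> is the one neighbor of a vertex just colored that may lose a color.\<close>

lemma two_list_coloring_aux:
  fixes adj :: "'b \<Rightarrow> 'b \<Rightarrow> bool" and side :: "'b \<Rightarrow> bool" and L :: "'b \<Rightarrow> nat set"
  assumes "finite X" "\<And>x y. adj x y \<Longrightarrow> adj y x"
    and "\<And>x y. x \<in> X \<Longrightarrow> y \<in> X \<Longrightarrow> adj x y \<Longrightarrow> side x \<noteq> side y"
    and "\<And>x. x \<in> X \<Longrightarrow> card {y \<in> X. adj x y} \<le> 2"
    and "\<And>x. x \<in> X \<Longrightarrow> z \<noteq> Some x \<Longrightarrow> 2 \<le> card (L x)"
    and "\<And>x. x \<in> X \<Longrightarrow> z = Some x \<Longrightarrow> L x \<noteq> {} \<and> card {y \<in> X. adj x y} \<le> 1"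
  shows "\<exists>f. (\<forall>x\<in>X. f x \<in> L x) \<and> (\<forall>x\<in>X. \<forall>y\<in>X. adj x y \<longrightarrow> f x \<noteq> f y)"
  using assms(1,3-6)
proof (induction "card X" arbitrary: X z L rule: less_induct)
  case less
  note fin = less.prems(1) and bip = less.prems(2) and deg = less.prems(3)
  have irr: "\<not> adj x x" if "x \<in> X" for x using bip that by blast
  \<comment> \<open>Coloring \<open>x\<close> with \<open>\<alpha>\<close> shortens at most one
    list. Its owner also loses the neighbor \<open>x\<close>, so it qualifies as the exceptional
    vertex of the rest.\<close>
  have step: ?case
    if x: "x \<in> X" "\<alpha> \<in> L x" and one: "card {y \<in> X. adj x y \<and> \<alpha> \<in> L y} \<le> 1"
      and big: "\<And>y. y \<in> X \<Longrightarrow> y \<noteq> x \<Longrightarrow> 2 \<le> card (L y)" for x \<alpha>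
  proof -
    define L' where "L' y = (if adj x y then L y - {\<alpha>} else L y)" for y
    let ?N = "{y \<in> X. adj x y \<and> \<alpha> \<in> L y}"
    have "finite ?N" using fin by simp
    then have "\<forall>y\<in>?N. \<forall>y'\<in>?N. y = y'" using one card_le_Suc0_iff_eq[of ?N] by simp
    then obtain z' where z': "?N \<subseteq> {z'}" by (cases "?N = {}") blast+
    have sub: "card {y \<in> X - {x}. adj u y} \<le> card {y \<in> X. adj u y}" for u
      by (rule card_mono) (use fin in auto)
    \<comment> \<open>When no list of a neighbor contains \<open>\<alpha>\<close>, \<open>z'\<close>
      is arbitrary; hence the test.\<close>
    define z'' where "z'' = (if adj x z' then Some z' else None)"
    have "\<exists>f. (\<forall>u\<in>X - {x}. f u \<in> L' u) \<and> (\<forall>u\<in>X - {x}. \<forall>y\<in>X - {x}. adj u y \<longrightarrow> f u \<noteq> f y)"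
    proof (rule less.hyps[of "X - {x}" z'' L'])
      show "card (X - {x}) < card X" using fin x by (meson card_Diff1_less)
      show "finite (X - {x})" using fin by simp
      show "card {y \<in> X - {x}. adj u y} \<le> 2" if "u \<in> X - {x}" for u
        using sub[of u] deg[of u] that by auto
      show "side u \<noteq> side y" if "u \<in> X - {x}" "y \<in> X - {x}" "adj u y" for u y
        using bip that by blast
      show "2 \<le> card (L' u)" if "u \<in> X - {x}" "z'' \<noteq> Some u" for u
      proof -
        have "L' u = L u" using that z' by (auto simp: L'_def z''_def split: if_splits)
        then show ?thesis using big that by simp
      qed
      show "L' t \<noteq> {} \<and> card {y \<in> X - {x}. adj t y} \<le> 1" if "t \<in> X - {x}" "z'' = Some t" for t
      proof
        have z: "adj x t" "t \<in> X" "t \<noteq> x" using that by (auto simp: z''_def split: if_splits)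
        have "\<not> L t \<subseteq> {\<alpha>}" using big[OF z(2,3)] card_mono[of "{\<alpha>}" "L t"] by auto
        then show "L' t \<noteq> {}" unfolding L'_def by auto
        have "x \<in> {y \<in> X. adj t y}" using assms(2) z x by auto
        then have "card ({y \<in> X. adj t y} - {x}) < card {y \<in> X. adj t y}"
          using fin by (intro card_Diff1_less) auto
        moreover have "{y \<in> X. adj t y} - {x} = {y \<in> X - {x}. adj t y}" by auto
        ultimately show "card {y \<in> X - {x}. adj t y} \<le> 1" using deg[OF z(2)] by simp
      qed
    qed
    then obtain f where f: "\<And>u. u \<in> X - {x} \<Longrightarrow> f u \<in> L' u"
      "\<And>u y. u \<in> X - {x} \<Longrightarrow> y \<in> X - {x} \<Longrightarrow> adj u y \<Longrightarrow> f u \<noteq> f y" by blast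
    have fx: "f u \<noteq> \<alpha>" "f u \<in> L u" if "u \<in> X" "u \<noteq> x" "adj x u" for u
      using f(1)[of u] that by (auto simp: L'_def)
    have fL: "f u \<in> L u" if "u \<in> X" "u \<noteq> x" for u
      using f(1)[of u] that by (auto simp: L'_def split: if_splits)
    show ?thesis
    proof (intro exI[of _ "f(x := \<alpha>)"] conjI ballI impI)
      show "(f(x := \<alpha>)) u \<in> L u" if "u \<in> X" for u using that fL x by simp
      show "(f(x := \<alpha>)) u \<noteq> (f(x := \<alpha>)) y" if "u \<in> X" "y \<in> X" "adj u y" for u y
        using that f(2)[of u y] fx(1)[of u] fx(1)[of y] assms(2) irr by auto
    qed
  qed
  show ?case
  \<comment> \<open>An exceptional vertex in \<open>X\<close> falls under the first case, so in the
    second all lists have at least two colors.\<close>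
  proof (cases "\<exists>x\<in>X. card {y \<in> X. adj x y} \<le> 1 \<and> L x \<noteq> {} \<and> (\<forall>y\<in>X. y \<noteq> x \<longrightarrow> 2 \<le> card (L y))")
    case True
    then obtain x \<alpha> where x: "x \<in> X" "\<alpha> \<in> L x" "card {y \<in> X. adj x y} \<le> 1"
      "\<And>y. y \<in> X \<Longrightarrow> y \<noteq> x \<Longrightarrow> 2 \<le> card (L y)" by blast
    have "card {y \<in> X. adj x y \<and> \<alpha> \<in> L y} \<le> card {y \<in> X. adj x y}"
      by (rule card_mono) (use fin in auto)
    then show ?thesis using step[OF x(1,2)] x by simp
  next
    case False
    have big: "2 \<le> card (L x)" if "x \<in> X" for x
    proof (rule less.prems(4)[OF that])
      show "z \<noteq> Some x" using False less.prems(4) less.prems(5)[OF that] that by force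
    qed
    show ?thesis
    \<comment> \<open>If lists agree along all edges, one side takes minima and the other maxima.
      Otherwise some \<open>\<alpha>\<close> in \<open>L x\<close> is absent from the list of a
      neighbor \<open>y\<close>, which leaves at most one neighbor to be affected.\<close>
    proof (cases "\<forall>x\<in>X. \<forall>y\<in>X. adj x y \<longrightarrow> L x = L y")
      case True
      have ne: "finite (L x) \<and> L x \<noteq> {} \<and> Min (L x) \<noteq> Max (L x)" if "x \<in> X" for x
      proof -
        have f: "finite (L x)" "L x \<noteq> {}" using big[OF that] card.infinite by fastforce+
        moreover have "Min (L x) \<noteq> Max (L x)"
        proof
          assume "Min (L x) = Max (L x)"
          then have "L x \<subseteq> {Min (L x)}" using f by (metis Max_ge Min_le le_antisym singletonI subsetI)
          then have "card (L x) \<le> 1" using card_mono[of "{Min (L x)}" "L x"] by simp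
          then show False using big[OF that] by simp
        qed
        ultimately show ?thesis by blast
      qed
      show ?thesis
      proof (intro exI[of _ "\<lambda>x. if side x then Min (L x) else Max (L x)"] conjI ballI impI)
        show "(if side x then Min (L x) else Max (L x)) \<in> L x" if "x \<in> X" for x
          using ne[OF that] by simp
        show "(if side x then Min (L x) else Max (L x)) \<noteq> (if side y then Min (L y) else Max (L y))"
          if "x \<in> X" "y \<in> X" "adj x y" for x y
          using ne[OF that(1)] True that bip[OF that] by auto
      qed
    next
      case neq: False
      obtain x y where xy: "x \<in> X" "y \<in> X" "adj x y" "\<not> L x \<subseteq> L y"
        using neq assms(2) by blast
      then obtain \<alpha> where \<alpha>: "\<alpha> \<in> L x" "\<alpha> \<notin> L y" by blast
      have "card {u \<in> X. adj x u \<and> \<alpha> \<in> L u} \<le> card ({u \<in> X. adj x u} - {y})"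
        by (rule card_mono) (use fin \<alpha> in auto)
      also have "\<dots> < card {u \<in> X. adj x u}"
        using fin xy by (intro card_Diff1_less) auto
      finally have "card {u \<in> X. adj x u \<and> \<alpha> \<in> L u} \<le> 1" using deg[OF xy(1)] by simp
      then show ?thesis using step[OF xy(1) \<alpha>(1)] big by blast
    qed
  qed
qed

lemma two_list_coloring:
  fixes adj :: "'b \<Rightarrow> 'b \<Rightarrow> bool" and side :: "'b \<Rightarrow> bool" and L :: "'b \<Rightarrow> nat set"
  assumes "finite X" "\<And>x y. adj x y \<Longrightarrow> adj y x"
    and "\<And>x y. x \<in> X \<Longrightarrow> y \<in> X \<Longrightarrow> adj x y \<Longrightarrow> side x \<noteq> side y"
    and "\<And>x. x \<in> X \<Longrightarrow> card {y \<in> X. adj x y} \<le> 2"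
    and "\<And>x. x \<in> X \<Longrightarrow> 2 \<le> card (L x)"
  obtains f where "\<And>x. x \<in> X \<Longrightarrow> f x \<in> L x"
    and "\<And>x y. x \<in> X \<Longrightarrow> y \<in> X \<Longrightarrow> adj x y \<Longrightarrow> f x \<noteq> f y"
  using two_list_coloring_aux[of X adj side None L] assms by (simp) blast

text \<open>Each \<open>b\<close> stands for a path \<open>w b\<close>, \<open>b\<close>,
  \<open>u b\<close> with edge colors \<open>p b\<close> and \<open>q b\<close>. If
  \<open>u b\<close> is no value of \<open>w\<close>, this path can be colored at once: the color
  lost at \<open>w b\<close> is offset by one path fewer there. When no such path remains, counting
  makes \<open>w\<close> injective, and the conflict graph is bipartite with degrees at most
  2.\<close>

lemma pair_list_coloring:
  fixes w u :: "'b \<Rightarrow> 'v" and L :: "'v \<Rightarrow> nat set"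
  assumes "finite S" "inj_on u S" "\<And>b. b \<in> S \<Longrightarrow> w b \<noteq> u b"
    and "\<And>b. b \<in> S \<Longrightarrow> 1 + card {a \<in> S. w a = w b} \<le> card (L (w b))"
    and "\<And>b. b \<in> S \<Longrightarrow> 1 + card {a \<in> S. w a = u b} \<le> card (L (u b))"
  shows "\<exists>p q. (\<forall>b\<in>S. p b \<in> L (w b) \<and> q b \<in> L (u b) \<and> p b \<noteq> q b) \<and>
    (\<forall>a\<in>S. \<forall>b\<in>S. a \<noteq> b \<and> w a = w b \<longrightarrow> p a \<noteq> p b) \<and>
    (\<forall>a\<in>S. \<forall>b\<in>S. w a = u b \<longrightarrow> p a \<noteq> q b)"
  using assms
proof (induction "card S" arbitrary: S L rule: less_induct)
  case less
  note fin = less.prems(1) and inj = less.prems(2) and wu = less.prems(3)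
    and Lw = less.prems(4) and Lu = less.prems(5)
  show ?case
  proof (cases "\<exists>b\<in>S. u b \<notin> w ` S")
    case True
    then obtain b where b: "b \<in> S" "u b \<notin> w ` S" by blast
    have "L (u b) \<noteq> {}" using Lu[OF b(1)] by fastforce
    then obtain q0 where q0: "q0 \<in> L (u b)" by blast
    have "0 < card {a \<in> S. w a = w b}" using fin b(1) by (subst card_gt_0_iff) auto
    then have "2 \<le> card (L (w b))" using Lw[OF b(1)] by simp
    then have "\<not> L (w b) \<subseteq> {q0}" using card_mono[of "{q0}" "L (w b)"] by auto
    then obtain p0 where p0: "p0 \<in> L (w b)" "p0 \<noteq> q0" by blast
    define L' where "L' = L(w b := L (w b) - {p0})"
    let ?S = "S - {b}"
    have cnt: "1 + card {a \<in> ?S. w a = v} \<le> card (L' v)"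
      if v: "1 + card {a \<in> S. w a = v} \<le> card (L v)" for v
    proof (cases "v = w b")
      case True
      have "{a \<in> ?S. w a = v} = {a \<in> S. w a = v} - {b}" by auto
      then have "card {a \<in> ?S. w a = v} < card {a \<in> S. w a = v}"
        using fin b(1) True card_Diff1_less[of "{a \<in> S. w a = v}" b] by simp
      moreover have "card (L' v) = card (L v) - 1" using True p0 by (simp add: L'_def)
      ultimately show ?thesis using v by linarith
    next
      case False
      then have "{a \<in> ?S. w a = v} = {a \<in> S. w a = v}" "L' v = L v" by (auto simp: L'_def)
      then show ?thesis using v by simp
    qed
    have "\<exists>p q. (\<forall>b\<in>?S. p b \<in> L' (w b) \<and> q b \<in> L' (u b) \<and> p b \<noteq> q b) \<and>
      (\<forall>a\<in>?S. \<forall>b\<in>?S. a \<noteq> b \<and> w a = w b \<longrightarrow> p a \<noteq> p b) \<and>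
      (\<forall>a\<in>?S. \<forall>b\<in>?S. w a = u b \<longrightarrow> p a \<noteq> q b)"
    proof (rule less.hyps)
      show "card ?S < card S" using fin b(1) by (rule card_Diff1_less)
      show "inj_on u ?S" using inj by (rule inj_on_diff)
    qed (use fin wu Lw Lu cnt in auto)
    then obtain p q where pq: "\<And>a. a \<in> ?S \<Longrightarrow> p a \<in> L' (w a) \<and> q a \<in> L' (u a) \<and> p a \<noteq> q a"
      "\<And>a c. a \<in> ?S \<Longrightarrow> c \<in> ?S \<Longrightarrow> a \<noteq> c \<Longrightarrow> w a = w c \<Longrightarrow> p a \<noteq> p c"
      "\<And>a c. a \<in> ?S \<Longrightarrow> c \<in> ?S \<Longrightarrow> w a = u c \<Longrightarrow> p a \<noteq> q c"
      by blast
    have L': "i \<in> L' v \<Longrightarrow> i \<in> L v \<and> (v = w b \<longrightarrow> i \<noteq> p0)" for i v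
      by (auto simp: L'_def split: if_splits)
    have pa: "p a \<in> L (w a)" "w a = w b \<Longrightarrow> p a \<noteq> p0" if "a \<in> S" "a \<noteq> b" for a
      using L'[of "p a" "w a"] pq(1)[of a] that by auto
    have qa: "q a \<in> L (u a)" "w b = u a \<Longrightarrow> p0 \<noteq> q a" if "a \<in> S" "a \<noteq> b" for a
      using L'[of "q a" "u a"] pq(1)[of a] that by auto
    show ?thesis
    proof (rule exI[of _ "p(b := p0)"], rule exI[of _ "q(b := q0)"], intro conjI ballI impI)
      fix a assume a: "a \<in> S"
      show "(p(b := p0)) a \<in> L (w a)" "(q(b := q0)) a \<in> L (u a)" "(p(b := p0)) a \<noteq> (q(b := q0)) a"
        using a pa qa pq(1)[of a] p0 q0 by auto
      fix c assume c: "c \<in> S"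
      show "(p(b := p0)) a \<noteq> (p(b := p0)) c" if "a \<noteq> c \<and> w a = w c"
        using a c that pq(2)[of a c] pa(2)[of a] pa(2)[of c] by auto
      show "(p(b := p0)) a \<noteq> (q(b := q0)) c" if "w a = u c"
      proof (cases "c = b")
        case True
        then have "u b = w a" using that by simp
        then show ?thesis using b(2) a by blast
      next
        case False then show ?thesis using a c that pq(3)[of a c] qa(2)[of c] by auto
      qed
    qed
  next
    case False
    then have "u ` S \<subseteq> w ` S" by auto
    then have "card S \<le> card (w ` S)" using fin inj card_mono[of "w ` S" "u ` S"] by (simp add: card_image)
    then have injw: "inj_on w S" using fin by (simp add: card_image_le eq_card_imp_inj_on le_antisym)
    \<comment> \<open>\<open>(b, True)\<close> and \<open>(b, False)\<close> are the edges from
      \<open>b\<close> to \<open>w b\<close> and to \<open>u b\<close>; \<open>vx\<close> is the end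
      other than \<open>b\<close>.\<close>
    define X where "X = S \<times> (UNIV :: bool set)"
    define vx where "vx = (\<lambda>(b, s). if s then w b else u b)"
    define adj where "adj = (\<lambda>x y. snd x \<noteq> snd y \<and> (fst x = fst y \<or> vx x = vx y))"
    have injv: "fst x = fst y" if "x \<in> X" "y \<in> X" "snd x = snd y" "vx x = vx y" for x y
      using that injw inj by (auto simp: X_def vx_def dest: inj_onD split: if_splits)
    obtain f where f: "\<And>x. x \<in> X \<Longrightarrow> f x \<in> L (vx x)"
      "\<And>x y. x \<in> X \<Longrightarrow> y \<in> X \<Longrightarrow> adj x y \<Longrightarrow> f x \<noteq> f y"
    proof (rule two_list_coloring[of X adj snd "L \<circ> vx"])
      show "finite X" using fin by (simp add: X_def)
      show "adj y x" if "adj x y" for x y using that by (auto simp: adj_def)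
      show "snd x \<noteq> snd y" if "adj x y" for x y using that by (simp add: adj_def)
      show "card {y \<in> X. adj x y} \<le> 2" if "x \<in> X" for x
      proof -
        let ?A = "{y \<in> X. snd y \<noteq> snd x \<and> fst y = fst x}" and ?B = "{y \<in> X. snd y \<noteq> snd x \<and> vx y = vx x}"
        have "?A \<subseteq> {(fst x, \<not> snd x)}" by auto
        then have A: "card ?A \<le> 1" using card_mono[of "{(fst x, \<not> snd x)}" ?A] by simp
        have "y = y'" if "y \<in> ?B" "y' \<in> ?B" for y y'
          using that injv[of y y'] by (simp add: prod_eq_iff)
        then have B: "card ?B \<le> 1"
          using fin card_le_Suc0_iff_eq[of ?B] by (simp add: X_def)
        have "{y \<in> X. adj x y} \<subseteq> ?A \<union> ?B" by (auto simp: adj_def)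
        then have "card {y \<in> X. adj x y} \<le> card (?A \<union> ?B)"
          using fin by (intro card_mono) (auto simp: X_def)
        also have "\<dots> \<le> card ?A + card ?B" by (rule card_Un_le)
        finally show ?thesis using A B by simp
      qed
      show "2 \<le> card ((L \<circ> vx) x)" if xX: "x \<in> X" for x
      proof -
        obtain b s where x: "x = (b, s)" "b \<in> S" using xX by (auto simp: X_def)
        have "vx x \<in> w ` S" using x False by (auto simp: vx_def)
        then have "0 < card {a \<in> S. w a = vx x}" using fin by (subst card_gt_0_iff) auto
        then show ?thesis using Lw[OF x(2)] Lu[OF x(2)] x by (auto simp: vx_def split: if_splits)
      qed
    qed (use that in auto)
    show ?thesis
    proof (rule exI[of _ "\<lambda>b. f (b, True)"], rule exI[of _ "\<lambda>b. f (b, False)"], intro conjI ballI impI)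
      fix a assume a: "a \<in> S"
      show "f (a, True) \<in> L (w a)" "f (a, False) \<in> L (u a)" "f (a, True) \<noteq> f (a, False)"
        using f(1)[of "(a, True)"] f(1)[of "(a, False)"] f(2)[of "(a, True)" "(a, False)"] a
        by (auto simp: X_def vx_def adj_def)
      fix c assume c: "c \<in> S"
      show "f (a, True) \<noteq> f (c, True)" if "a \<noteq> c \<and> w a = w c"
        using that a c injw by (auto dest: inj_onD)
      show "f (a, True) \<noteq> f (c, False)" if "w a = u c"
        using f(2)[of "(a, True)" "(c, False)"] a c that by (auto simp: X_def vx_def adj_def)
    qed
  qed
qed

section \<open>The total coloring\<close>

text \<open>The edges form a matching: the end of each edge chosen by \<open>h\<close> gets 0, all
  other vertices get 1, and edges get 2.\<close>

lemma total_colorable_3: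
  assumes "finite E" "\<forall>e\<in>E. card e = 2" "\<And>v. degree E v \<le> 1"
  shows "total_colorable V E 3"
proof -
  have uniq: "e = e'" if "e \<in> E" "e' \<in> E" "v \<in> e" "v \<in> e'" for e e' v
    using assms(1) assms(3)[of v] that card_le_Suc0_iff_eq[of "{e \<in> E. v \<in> e}"] by (auto simp: degree_def)
  define h where "h e = (SOME x. x \<in> e)" for e :: "'a set"
  have h: "h e \<in> e" if "e \<in> E" for e
    unfolding h_def using assms(2) that by (metis card.empty ex_in_conv someI_ex zero_neq_numeral)
  define f :: "'a \<Rightarrow> nat" where "f v = (if \<exists>e\<in>E. v = h e then 0 else 1)" for v
  have "f u \<noteq> f v" if e: "{u, v} \<in> E" for u v
  proof -
    have ne: "u \<noteq> v" using assms(2) e by auto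
    have "(\<exists>e'\<in>E. z = h e') \<longleftrightarrow> z = h {u, v}" if "z \<in> {u, v}" for z
      using uniq h e that by metis
    then show ?thesis using h[OF e] ne unfolding f_def by auto
  qed
  moreover have "(2::nat) \<noteq> f v" for v by (simp add: f_def)
  ultimately have "total_coloring V E f (\<lambda>_. 2)"
    unfolding total_coloring_def using uniq by blast
  moreover have "f ` V \<union> (\<lambda>_. 2) ` E \<subseteq> {..<3}" by (auto simp: f_def)
  ultimately show ?thesis unfolding total_colorable_def by blast
qed

lemma total_colorable_of_5_coloring:
  assumes G: "finite_simple_graph V E" and D: "2 \<le> D" "\<And>v. degree E v \<le> D"
    and c: "proper_coloring V E c" "c ` V \<subseteq> {..<5}"
  shows "total_colorable V E (D + 3)"
proof -
  have finE: "finite E" using G by (rule finite_simple_graph_finite_edges)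
  have finV: "finite V" and two: "\<forall>e\<in>E. card e = 2" and EV: "\<And>e. e \<in> E \<Longrightarrow> e \<subseteq> V"
    using G by (auto simp: finite_simple_graph_def simple_graph_def)
  have cne: "c x \<noteq> c y" if "{x, y} \<in> E" for x y
    using c(1) EV[OF that] that unfolding proper_coloring_def by blast
  have c5: "c v < 5" if "v \<in> V" for v using c(2) that by auto

  \<comment> \<open>The edges to recolor and the exceptional vertices\<close>
  obtain \<phi> where \<phi>: "edge_coloring E \<phi>" and \<phi>D: "\<And>e. e \<in> E \<Longrightarrow> \<phi> e < D + 1"
    using vizing[OF finE two, of "D + 1"] D(2)
    by (metis image_subset_iff le_imp_less_Suc lessThan_iff Suc_eq_plus1)
  note \<phi>_eq = edge_coloringD[OF \<phi>]
  define F where "F = {e \<in> E. \<phi> e < 2}"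
  define B where "B = {v \<in> V. c v = 4 \<and> (\<forall>i\<in>{2..D}. \<exists>e\<in>E. v \<in> e \<and> \<phi> e = i)}"
  define B1 where "B1 = {b \<in> B. \<exists>e\<in>F. b \<in> e}"
  have FE: "F \<subseteq> E" and finF: "finite F" and finB: "finite B" and B1B: "B1 \<subseteq> B" and finB1: "finite B1"
    using finE finV by (auto simp: F_def B_def B1_def)
  have B4: "c b = 4" if "b \<in> B" for b using that by (simp add: B_def)
  have "\<exists>z. {b, z} \<in> E \<and> \<phi> {b, z} = 2" if b: "b \<in> B" for b
  proof -
    have "2 \<in> {2..D}" using D(1) by simp
    then obtain e where "e \<in> E" "b \<in> e" "\<phi> e = 2" using b unfolding B_def by blast
    then show ?thesis using two by (metis card_2_memE)
  qed
  then obtain u where u: "\<And>b. b \<in> B \<Longrightarrow> {b, u b} \<in> E \<and> \<phi> {b, u b} = 2" by metis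
  have "\<exists>z. {b, z} \<in> F" if "b \<in> B1" for b
    using that two FE unfolding B1_def by (auto elim!: card_2_memE)
  then obtain w where w: "\<And>b. b \<in> B1 \<Longrightarrow> {b, w b} \<in> F" by metis
  have c_nbr: "z \<in> V" "c z < 4" if "b \<in> B" "{b, z} \<in> E" for b z
    using c5[of z] cne[OF that(2)] B4[OF that(1)] EV[OF that(2)] by auto
  have cu: "u b \<in> V" "c (u b) < 4" if "b \<in> B" for b using c_nbr[OF that] u[OF that] by auto
  have cw: "w b \<in> V" "c (w b) < 4" if "b \<in> B1" for b using c_nbr[of b] w[OF that] that B1B FE by auto
  \<comment> \<open>At most \<open>D\<close> edges meet \<open>b\<close>, and the colors from 2 to
    \<open>D\<close> take \<open>D - 1\<close> of them.\<close>
  have Funiq: "e = e'" if "b \<in> B" "e \<in> F" "e' \<in> F" "b \<in> e" "b \<in> e'" for b e e'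
  proof -
    let ?A = "{e \<in> E. b \<in> e}"
    let ?H = "{e \<in> F. b \<in> e}"
    have "{2..D} \<subseteq> \<phi> ` (?A - ?H)" using that(1) by (force simp: B_def F_def)
    then have "card {2..D} \<le> card (\<phi> ` (?A - ?H))" using finE by (intro card_mono) auto
    also have "\<dots> \<le> card (?A - ?H)" using finE by (intro card_image_le) auto
    also have "\<dots> = card ?A - card ?H" using FE finF by (intro card_Diff_subset) auto
    finally have "card ?H \<le> 1" using D(2)[of b] D(1) by (simp add: degree_def)
    then show ?thesis using that finF card_le_Suc0_iff_eq[of ?H] by auto
  qed
  have injw: "{b, w b} = e" if "b \<in> B1" "e \<in> F" "b \<in> e" for b e
    using Funiq[of b "{b, w b}" e] w that B1B by auto
  have inju: "b = b'" if "b \<in> B" "b' \<in> B" "u b = u b'" for b b'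
  proof -
    have "{b, u b} = {b', u b'}" by (rule \<phi>_eq[of _ _ "u b"]) (use u[OF that(1)] u[OF that(2)] that(3) in auto)
    then show ?thesis using that cu(2) B4 by (metis doubleton_eq_iff)
  qed
  have wu: "w b \<noteq> u b" if "b \<in> B1" for b
    using u[of b] w[OF that] that B1B by (auto simp: F_def)

  \<comment> \<open>Recoloring the edges of \<open>F\<close> away from \<open>B\<close>\<close>
  define F0 where "F0 = {e \<in> F. e \<inter> B = {}}"
  have F0F: "F0 \<subseteq> F" and finF0: "finite F0" using finF by (auto simp: F0_def)
  define adj where "adj = (\<lambda>e e' :: 'a set. e \<noteq> e' \<and> e \<inter> e' \<noteq> {})"
  obtain h where h: "\<And>e. e \<in> F0 \<Longrightarrow> h e \<in> {..<4} - c ` e"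
    "\<And>e e'. e \<in> F0 \<Longrightarrow> e' \<in> F0 \<Longrightarrow> adj e e' \<Longrightarrow> h e \<noteq> h e'"
  \<comment> \<open>The old colors 0 and 1 give the two sides. Each end of an edge lies on at most
    one other edge of \<open>F0\<close>, and the classes of the ends exclude at most two of four
    colors.\<close>
  proof (rule two_list_coloring[of F0 adj "\<lambda>e. \<phi> e = 0" "\<lambda>e. {..<4} - c ` e"])
    show "finite F0" by (rule finF0)
    show "adj e' e" if "adj e e'" for e e' using that by (auto simp: adj_def)
    have opp: "\<phi> e' = 1 - \<phi> e" if "e \<in> F0" "e' \<in> F0" "adj e e'" for e e'
    proof -
      have "\<phi> e \<noteq> \<phi> e'" "\<phi> e < 2" "\<phi> e' < 2"
        using that \<phi> F0F unfolding edge_coloring_def F_def adj_def by blast+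
      then show ?thesis by linarith
    qed
    show "(\<phi> e = 0) \<noteq> (\<phi> e' = 0)" if "e \<in> F0" "e' \<in> F0" "adj e e'" for e e'
      using opp[OF that] that(1) F0F by (auto simp: F_def)
    show "card {e' \<in> F0. adj e e'} \<le> 2" if e: "e \<in> F0" for e
    proof -
      have eE: "e \<in> E" using e F0F FE by blast
      obtain x y where xy: "e = {x, y}" using two eE by (meson card_2_iff)
      let ?N = "\<lambda>x. {e' \<in> F0. adj e e' \<and> x \<in> e'}"
      have one: "card (?N z) \<le> 1" for z
      proof -
        have "e1 = e2" if "e1 \<in> ?N z" "e2 \<in> ?N z" for e1 e2
          using that opp[OF e, of e1] opp[OF e, of e2] \<phi>_eq[of e1 e2 z] F0F FE by auto
        then show ?thesis using finF0 card_le_Suc0_iff_eq[of "?N z"] by simp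
      qed
      have "{e' \<in> F0. adj e e'} = ?N x \<union> ?N y" using xy by (auto simp: adj_def)
      then have "card {e' \<in> F0. adj e e'} \<le> card (?N x) + card (?N y)" by (simp add: card_Un_le)
      then show ?thesis using one[of x] one[of y] by linarith
    qed
    show "2 \<le> card ({..<4} - c ` e)" if "e \<in> F0" for e
    proof -
      have e: "card e = 2" using that F0F FE two by blast
      then have "finite e" using card.infinite by fastforce
      then have "card (c ` e) \<le> 2" using e card_image_le[of e c] by simp
      then show ?thesis using diff_card_le_card_Diff[of "c ` e" "{..<4}"] \<open>finite e\<close> by simp
    qed
  qed (use that in auto)

  \<comment> \<open>Recoloring the edges at \<open>B\<close>\<close>
  define L where "L v = {..<4} - {c v} - h ` {e \<in> F0. v \<in> e}" for v
  \<comment> \<open>At most two edges of \<open>F\<close> meet \<open>v\<close>. Those in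
    \<open>F0\<close> remove colors from the three other than \<open>c v\<close>, while those from
    \<open>B1\<close> are counted by the set on the left.\<close>
  have L: "1 + card {b \<in> B1. w b = v} \<le> card (L v)" if v: "v \<in> V" "c v < 4" for v
  proof -
    let ?F = "{e \<in> F. v \<in> e}" and ?I = "{e \<in> F0. v \<in> e}" and ?W = "{b \<in> B1. w b = v}"
    have F2: "card ?F \<le> 2"
    proof -
      have "card ?F = card (\<phi> ` ?F)"
        by (rule card_image[symmetric], rule inj_onI)
          (metis (mono_tags, lifting) mem_Collect_eq subsetD[OF FE] \<phi>_eq)
      also have "\<dots> \<le> card {..<2::nat}" by (rule card_mono) (auto simp: F_def)
      finally show ?thesis by simp
    qed
    have inj: "inj_on (\<lambda>b. {b, v}) ?W" by (rule inj_onI) (auto simp: doubleton_eq_iff)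
    have "?I \<union> (\<lambda>b. {b, v}) ` ?W \<subseteq> ?F" using F0F w by auto
    then have "card (?I \<union> (\<lambda>b. {b, v}) ` ?W) \<le> card ?F" using finF by (intro card_mono) auto
    moreover have "?I \<inter> (\<lambda>b. {b, v}) ` ?W = {}" using B1B by (auto simp: F0_def)
    then have "card (?I \<union> (\<lambda>b. {b, v}) ` ?W) = card ?I + card ((\<lambda>b. {b, v}) ` ?W)"
      using finF0 finB1 by (intro card_Un_disjoint) auto
    ultimately have "card ?I + card ?W \<le> card ?F" using card_image[OF inj] by simp
    moreover have "card (h ` ?I) \<le> card ?I" using finF0 by (intro card_image_le) auto
    moreover have "card ({..<4} - {c v}) - card (h ` ?I) \<le> card (L v)"
      unfolding L_def using finF0 by (intro diff_card_le_card_Diff) auto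
    moreover have "card ({..<4} - {c v}) = 3" using v(2) by simp
    ultimately show ?thesis using F2 by linarith
  qed
  have "\<exists>p q. (\<forall>b\<in>B1. p b \<in> L (w b) \<and> q b \<in> L (u b) \<and> p b \<noteq> q b) \<and>
    (\<forall>a\<in>B1. \<forall>b\<in>B1. a \<noteq> b \<and> w a = w b \<longrightarrow> p a \<noteq> p b) \<and>
    (\<forall>a\<in>B1. \<forall>b\<in>B1. w a = u b \<longrightarrow> p a \<noteq> q b)"
  proof (rule pair_list_coloring)
    show "inj_on u B1" by (rule inj_onI) (use inju B1B in blast)
  qed (use finB1 wu L cu cw B1B in auto)
  then obtain p q1 where pq: "\<And>b. b \<in> B1 \<Longrightarrow> p b \<in> L (w b)" "\<And>b. b \<in> B1 \<Longrightarrow> q1 b \<in> L (u b)"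
    "\<And>b. b \<in> B1 \<Longrightarrow> p b \<noteq> q1 b"
    "\<And>a b. a \<in> B1 \<Longrightarrow> b \<in> B1 \<Longrightarrow> a \<noteq> b \<Longrightarrow> w a = w b \<Longrightarrow> p a \<noteq> p b"
    "\<And>a b. a \<in> B1 \<Longrightarrow> b \<in> B1 \<Longrightarrow> w a = u b \<Longrightarrow> p a \<noteq> q1 b" by blast
  \<comment> \<open>For \<open>b\<close> outside \<open>B1\<close> only the edge to
    \<open>u b\<close> needs a color, and its list is larger than the set of values of
    \<open>p\<close> to avoid. All edges \<open>{b, u b}\<close> have old color 2, so different ones
    do not meet and \<open>q\<close> can be chosen separately for each \<open>b\<close>.\<close>
  have "\<exists>i. i \<in> L (u b) \<and> (\<forall>a\<in>B1. w a = u b \<longrightarrow> p a \<noteq> i) \<and> (b \<in> B1 \<longrightarrow> p b \<noteq> i)" if b: "b \<in> B" for b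
  proof (cases "b \<in> B1")
    case True
    then show ?thesis using pq by blast
  next
    case False
    let ?W = "{a \<in> B1. w a = u b}"
    have "card (p ` ?W) \<le> card ?W" using finB1 by (intro card_image_le) auto
    then have "card (p ` ?W) < card (L (u b))" using L[OF cu[OF b]] by linarith
    then have "\<not> L (u b) \<subseteq> p ` ?W" using finB1 card_mono[of "p ` ?W" "L (u b)"] by auto
    then show ?thesis using False by blast
  qed
  then obtain q where q: "\<And>b. b \<in> B \<Longrightarrow> q b \<in> L (u b)"
    "\<And>a b. a \<in> B1 \<Longrightarrow> b \<in> B \<Longrightarrow> w a = u b \<Longrightarrow> p a \<noteq> q b" "\<And>b. b \<in> B1 \<Longrightarrow> p b \<noteq> q b"
    using B1B by (metis subsetD)

  \<comment> \<open>The total coloring and the four kinds of edges\<close>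
  have "\<exists>i. i \<in> {2..D} \<and> (\<forall>e\<in>E. v \<in> e \<longrightarrow> \<phi> e \<noteq> i)" if "v \<in> V" "c v = 4" "v \<notin> B" for v
    using that by (auto simp: B_def)
  then obtain m where m: "\<And>v. v \<in> V \<Longrightarrow> c v = 4 \<Longrightarrow> v \<notin> B \<Longrightarrow> m v \<in> {2..D}"
    "\<And>v e. v \<in> V \<Longrightarrow> c v = 4 \<Longrightarrow> v \<notin> B \<Longrightarrow> e \<in> E \<Longrightarrow> v \<in> e \<Longrightarrow> \<phi> e \<noteq> m v" by metis
  \<comment> \<open>The value 4 on \<open>B\<close> is the shifted color 2, which becomes free at
    \<open>b\<close> because \<open>{b, u b}\<close> is recolored.\<close>
  define f where "f v = (if c v < 4 then c v else if v \<in> B then 4 else m v + 2)" for v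
  \<comment> \<open>On the edges at \<open>B\<close> the choice is unique, since the other end has a
    class below 4.\<close>
  define \<beta> where "\<beta> e = (SOME b. b \<in> e \<and> b \<in> B)" for e
  have \<beta>: "\<beta> {b, z} = b" if "b \<in> B" "c z < 4" for b z
    unfolding \<beta>_def using that B4[of z] by (intro some_equality) auto
  define g where "g e = (if e \<in> F0 then h e else if e \<in> F then p (\<beta> e)
    else if \<exists>b\<in>B. e = {b, u b} then q (\<beta> e) else \<phi> e + 2)" for e
  have kinds: "e \<in> F0 \<and> g e = h e \<or> (\<exists>b\<in>B1. e = {b, w b} \<and> g e = p b) \<or>
      (\<exists>b\<in>B. e = {b, u b} \<and> g e = q b) \<or>
      (2 \<le> \<phi> e \<and> g e = \<phi> e + 2 \<and> (\<forall>b\<in>B. b \<in> e \<longrightarrow> \<phi> e \<noteq> 2))" if e: "e \<in> E" for e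
  proof -
    consider "e \<in> F0" | "e \<in> F" "e \<notin> F0" | "e \<notin> F" "\<exists>b\<in>B. e = {b, u b}"
      | "e \<notin> F" "\<not> (\<exists>b\<in>B. e = {b, u b})" by blast
    then show ?thesis
    proof cases
      case 1
      then show ?thesis by (simp add: g_def)
    next
      case 2
      then obtain b where b: "b \<in> B" "b \<in> e" by (auto simp: F0_def)
      then have "b \<in> B1" using 2 by (auto simp: B1_def)
      then have "e = {b, w b}" "\<beta> e = b" using injw[of b e] 2 b \<beta>[of b "w b"] cw[of b] by auto
      then show ?thesis using 2 \<open>b \<in> B1\<close> by (auto simp: g_def)
    next
      case 3
      then obtain b where b: "b \<in> B" "e = {b, u b}" by blast
      then have "g e = q b" using 3 F0F \<beta>[of b "u b"] cu[of b] by (auto simp: g_def)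
      then show ?thesis using b by blast
    next
      case 4
      have "\<phi> e \<noteq> 2" if "b \<in> B" "b \<in> e" for b
        using \<phi>_eq[of e "{b, u b}" b] u[of b] that e 4 by auto
      then show ?thesis using 4 e F0F by (auto simp: g_def F_def)
    qed
  qed
  have Lb: "i < 4 \<and> i \<noteq> c v \<and> (\<forall>e\<in>F0. v \<in> e \<longrightarrow> h e \<noteq> i)" if "i \<in> L v" for i v
    using that by (auto simp: L_def)
  have p4: "p b < 4" if "b \<in> B1" for b using Lb[OF pq(1)[OF that]] by simp
  have q4: "q b < 4" if "b \<in> B" for b using Lb[OF q(1)[OF that]] by simp
  have hb: "h e < 4 \<and> (\<forall>v\<in>e. h e \<noteq> c v)" if "e \<in> F0" for e using h(1)[OF that] by auto
  have fB: "f b = 4" if "b \<in> B" for b using B4[OF that] that by (simp add: f_def)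
  have fc: "f v = c v \<or> 4 \<le> f v" if "v \<in> V" for v using m(1)[OF that] c5[OF that] by (auto simp: f_def)
  have f_small: "f v = c v" if "c v < 4" for v using that by (simp add: f_def)
  have f_cases: "f v < 4 \<or> v \<in> B \<or> (f v = m v + 2 \<and> c v = 4 \<and> v \<notin> B)" if "v \<in> V" for v
    using c5[OF that] by (auto simp: f_def)

  \<comment> \<open>Verification of the three conditions and of the range\<close>
  have vertices: "f x \<noteq> f y" if e: "{x, y} \<in> E" for x y
  proof -
    have V: "x \<in> V" "y \<in> V" using EV[OF e] by auto
    \<comment> \<open>Class 4 is independent, so two vertices with colors from 4 on are never
      adjacent.\<close>
    have "c x < 4 \<or> c y < 4" using cne[OF e] c5[OF V(1)] c5[OF V(2)] by linarith
    then show ?thesis using f_small fc[OF V(1)] fc[OF V(2)] cne[OF e] by (metis leD)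
  qed

  have incident: "g e \<noteq> f v" if e: "e \<in> E" "v \<in> e" for e v
  proof -
    have V: "v \<in> V" using EV e by blast
    from kinds[OF e(1)] consider "e \<in> F0" "g e = h e" | b where "b \<in> B1" "e = {b, w b}" "g e = p b"
      | b where "b \<in> B" "e = {b, u b}" "g e = q b"
      | "2 \<le> \<phi> e" "g e = \<phi> e + 2" "\<forall>b\<in>B. b \<in> e \<longrightarrow> \<phi> e \<noteq> 2" by blast
    then show ?thesis
    proof cases
      case 1
      then show ?thesis using hb[OF 1(1)] fc[OF V] e by auto
    next
      case 2
      then show ?thesis using Lb[OF pq(1)[OF 2(1)]] f_small[OF cw(2)[OF 2(1)]] fB[of b] B1B e(2) by auto
    next
      case 3
      then show ?thesis using Lb[OF q(1)[OF 3(1)]] f_small[OF cu(2)[OF 3(1)]] fB[OF 3(1)] e(2) by auto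
    next
      case 4
      then show ?thesis using f_cases[OF V] fB[of v] m(2)[OF V _ _ e] e(2) by auto
    qed
  qed

  have edges: "g e \<noteq> g e'" if e: "e \<in> E" "e' \<in> E" "e \<noteq> e'" "x \<in> e" "x \<in> e'" for e e' x
  proof -
    \<comment> \<open>Numbering the kinds of edges lets symmetry reduce the check to
      \<open>i \<le> j\<close>.\<close>
    define P where "P i d \<longleftrightarrow> (if i = 0 then d \<in> F0 \<and> g d = h d
      else if i = 1 then \<exists>b\<in>B1. d = {b, w b} \<and> g d = p b
      else if i = 2 then \<exists>b\<in>B. d = {b, u b} \<and> g d = q b
      else g d = \<phi> d + 2 \<and> 2 \<le> \<phi> d)" for i :: nat and d
    have P: "\<exists>i\<le>3. P i d" if "d \<in> E" for d
    proof -
      have "P 0 d \<or> P 1 d \<or> P 2 d \<or> P 3 d" using kinds[OF that] by (auto simp: P_def)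
      then show ?thesis by (elim disjE) (rule exI, rule conjI[rotated], assumption, simp)+
    qed
    have small: "g d < 4" if "P i d" "i < 3" for i d
      using that p4 q4 hb unfolding P_def by (auto split: if_splits)
    have main: "g d \<noteq> g d'" if ij: "i \<le> j" "P i d" "P j d'" "j \<le> 3"
      and d: "d \<in> E" "d' \<in> E" "d \<noteq> d'" "x \<in> d" "x \<in> d'" for i j d d'
    proof -
      have nF0: "b \<notin> d" if "b \<in> B" "d \<in> F0" for b d using that by (auto simp: F0_def)
      have "j = 3 \<and> i < 3 \<or> j = 3 \<and> i = 3 \<or> i = 0 \<and> j = 0 \<or> i = 0 \<and> j = 1 \<or> i = 0 \<and> j = 2 \<or>
        i = 1 \<and> j = 1 \<or> i = 1 \<and> j = 2 \<or> i = 2 \<and> j = 2"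
        using ij(1,4) by presburger
      then consider "j = 3" "i < 3" | "j = 3" "i = 3" | "i = 0" "j = 0" | "i = 0" "j = 1" | "i = 0" "j = 2"
        | "i = 1" "j = 1" | "i = 1" "j = 2" | "i = 2" "j = 2" by blast
      then show ?thesis
      proof cases
        case 1
        then show ?thesis using small[OF ij(2)] ij(3) by (simp add: P_def)
      next
        case 2
        then show ?thesis using ij \<phi>_eq[of d d' x] d by (auto simp: P_def)
      next
        case 3
        then show ?thesis using ij h(2)[of d d'] d by (auto simp: P_def adj_def)
      next
        case 4
        then obtain b where b: "b \<in> B1" "d' = {b, w b}" "g d' = p b" "d \<in> F0" "g d = h d"
          using ij by (auto simp: P_def)
        \<comment> \<open>\<open>d\<close> avoids \<open>B\<close>, so the edges meet at
          \<open>w b\<close>, and \<open>L (w b)\<close> excludes \<open>h d\<close>.\<close>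
        then have "x = w b" using nF0[of b d] d B1B by auto
        then show ?thesis using b Lb[OF pq(1)[OF b(1)]] d by auto
      next
        case 5
        then obtain b where b: "b \<in> B" "d' = {b, u b}" "g d' = q b" "d \<in> F0" "g d = h d"
          using ij by (auto simp: P_def)
        then have "x = u b" using nF0[of b d] d by auto
        then show ?thesis using b Lb[OF q(1)[OF b(1)]] d by auto
      next
        case 6
        then obtain a b where ab: "a \<in> B1" "d = {a, w a}" "g d = p a" "b \<in> B1" "d' = {b, w b}" "g d' = p b"
          using ij by (auto simp: P_def)
        \<comment> \<open>\<open>w a\<close> and \<open>w b\<close> have classes below 4 and hence
          lie outside \<open>B\<close>, so the edges can only meet there.\<close>
        then have "a \<noteq> b" "w a \<noteq> b" "w b \<noteq> a" using d cw(2)[of a] cw(2)[of b] B4 B1B by fastforce+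
        then have "w a = w b" using d ab by auto
        then show ?thesis using pq(4)[of a b] ab \<open>a \<noteq> b\<close> by simp
      next
        case 7
        then obtain a b where ab: "a \<in> B1" "d = {a, w a}" "g d = p a" "b \<in> B" "d' = {b, u b}" "g d' = q b"
          using ij by (auto simp: P_def)
        then have "w a \<noteq> b" "u b \<noteq> a" using cw(2)[of a] cu(2)[of b] B4 B1B by fastforce+
        then have "a = b \<or> w a = u b" using d ab by auto
        then show ?thesis using q ab by auto
      next
        \<comment> \<open>Two distinct edges of old color 2 cannot meet.\<close>
        case 8
        then obtain a b where ab: "a \<in> B" "d = {a, u a}" "b \<in> B" "d' = {b, u b}"
          using ij by (auto simp: P_def)
        then show ?thesis using \<phi>_eq[of d d' x] u d by auto
      qed
    qed
    obtain i j where "i \<le> 3" "j \<le> 3" "P i e" "P j e'" using P e by blast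
    then show ?thesis using main[of i j e e'] main[of j i e' e] e by (metis nle_le)
  qed

  have "total_coloring V E f g"
    unfolding total_coloring_def using vertices edges incident by blast
  moreover have "f ` V \<union> g ` E \<subseteq> {..<D + 3}"
  proof -
    \<comment> \<open>The color 4 is in range because \<open>D\<close> is at least 2;
      \<open>m v + 2\<close> is at most \<open>D + 2\<close>.\<close>
    have "f v < D + 3" if "v \<in> V" for v
      using m(1)[OF that] c5[OF that] D(1) by (cases "c v = 4 \<and> v \<notin> B") (auto simp: f_def)
    moreover have "g e < D + 3" if "e \<in> E" for e
    proof -
      have "g e < 4 \<or> g e = \<phi> e + 2" using kinds[OF that] hb p4 q4 by metis
      then show ?thesis using \<phi>D[OF that] D(1) by linarith
    qed
    ultimately show ?thesis by auto
  qed
  ultimately show ?thesis unfolding total_colorable_def by blast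
qed

theorem theorem12:
  fixes V :: "'a set" and E :: "'a set set"
  assumes "finite_simple_graph V E"
    and "connected_graph V E"
    and "chromatic_number V E \<le> 5"
  shows "total_chromatic_number V E \<le> max_degree V E + 3"
proof -
  let ?D = "max_degree V E"
  have fin: "finite V" "finite E" "\<forall>e\<in>E. card e = 2" "\<forall>e\<in>E. e \<subseteq> V"
    using assms(1) finite_simple_graph_finite_edges by (auto simp: finite_simple_graph_def simple_graph_def)
  \<comment> \<open>Points outside \<open>V\<close> have degree 0, so the bound holds on the whole
    type, as \<open>vizing\<close> requires.\<close>
  have deg: "degree E v \<le> ?D" for v
  proof (cases "v \<in> V")
    case True
    then show ?thesis using fin(1) unfolding max_degree_def by (intro Max_ge) auto
  next
    case False
    then have "{e \<in> E. v \<in> e} = {}" using fin(4) by blast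
    then have "degree E v = 0" unfolding degree_def by (simp only: card.empty)
    then show ?thesis by simp
  qed
  \<comment> \<open>The construction needs room for the color 4; for a maximum degree below 2 the
    edges form a matching and three colors suffice.\<close>
  have "\<exists>k\<le>?D + 3. total_colorable V E k"
  proof (cases "2 \<le> ?D")
    case True
    obtain c where "proper_coloring V E c" "c ` V \<subseteq> {..<chromatic_number V E}"
      using colorable_chromatic_number[OF assms(1)] by (auto simp: colorable_def)
    then have "total_colorable V E (?D + 3)"
      using assms(3) by (intro total_colorable_of_5_coloring[OF assms(1) True deg]) auto
    then show ?thesis by blast
  next
    case False
    then have "degree E v \<le> 1" for v using deg[of v] by linarith
    then show ?thesis using total_colorable_3[OF fin(2,3)] by (metis le_add2)
  qed
  then show ?thesis unfolding total_chromatic_number_def by (meson Least_le le_trans)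
qed
end
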